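(* Let $\alpha\in\mathbb{N}\cup\{0\}$. Then there exist a constant $c>0$, a constant $c_1>0$, a sequence of smooth functions $h_k$ on $B_1$, and a sequence of solutions $u_k$ of $$\Delta u_k+|x|^{2\alpha}h_k(x)e^{u_k(x)}=0\quad\text{in } B_1$$ such that: (i) $\frac{1}{c_1}\le h_k(x)\le c_1$ and $|\nabla^{\beta}h_k(x)|\le c_1$ for all $x\in B_1$ and all multi-indices $|\beta|=1,2,3$; (ii) $|\Delta(\log h_k)(0)|\ge c$ for all $k$; (iii) $\{u_k\}$ is a blow-up sequence whose only blow-up point in $B_1$ is the origin, and it is simple, i.e. it satisfies the spherical Harnack inequality around the origin; (iv) there is $C>0$ independent of $k$ with $|u_k(x)-u_k(y)|\le C$ for all $x,y\in\partial B_1$, and $\int_{B_1}|x|^{2\alpha}h_k(x)e^{u_k(x)}\,dx\le C$.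
   Context: $B_1$ is the open unit disk in $\mathbb{R}^2$. A sequence $\{u_k\}$ is a blow-up sequence with the origin as its only blow-up point in $B_1$ if there are points $x_k\to 0$ with $u_k(x_k)\to+\infty$, while for every compact $K\subset\overline{B_1}\setminus\{0\}$ the functions $u_k$ are uniformly bounded above on $K$. The sequence satisfies the spherical Harnack inequality around the origin (is "simple") if there is a constant $C>0$ independent of $k$ and $r$ such that $|u_k(x)-u_k(y)|\le C$ whenever $|x|=|y|=r\in(0,1)$; a blow-up sequence violating this is called non-simple. *)

theory Defs
  imports "HOL-Analysis.Analysis"
begin

text \<open>Points of the plane are modelled as pairs of reals; the product norm on
  real \<times> real is the Euclidean norm, so ball 0 1 is the open unit disk.\<close>

type_synonym R2 = "real \<times> real"

definition partial :: "bool \<Rightarrow> (R2 \<Rightarrow> real) \<Rightarrow> R2 \<Rightarrow> real" where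
  "partial b f = (\<lambda>(x1, x2). if b then deriv (\<lambda>t. f (x1, t)) x2
                                   else deriv (\<lambda>t. f (t, x2)) x1)"

definition has_partial :: "bool \<Rightarrow> (R2 \<Rightarrow> real) \<Rightarrow> R2 \<Rightarrow> bool" where
  "has_partial b f p = (case p of (x1, x2) \<Rightarrow>
      (if b then (\<lambda>t. f (x1, t)) differentiable (at x2)
            else (\<lambda>t. f (t, x2)) differentiable (at x1)))"

definition dpartial :: "bool list \<Rightarrow> (R2 \<Rightarrow> real) \<Rightarrow> R2 \<Rightarrow> real" where
  "dpartial ws f = foldr partial ws f"

definition Ck_on :: "nat \<Rightarrow> R2 set \<Rightarrow> (R2 \<Rightarrow> real) \<Rightarrow> bool" where
  "Ck_on k U f \<longleftrightarrow>
     (\<forall>ws. length ws \<le> k \<longrightarrow> continuous_on U (dpartial ws f)) \<and>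
     (\<forall>ws b. length ws < k \<longrightarrow> (\<forall>p\<in>U. has_partial b (dpartial ws f) p))"

definition smooth_on :: "R2 set \<Rightarrow> (R2 \<Rightarrow> real) \<Rightarrow> bool" where
  "smooth_on U f \<longleftrightarrow> (\<forall>k. Ck_on k U f)"

definition laplacian :: "(R2 \<Rightarrow> real) \<Rightarrow> R2 \<Rightarrow> real" where
  "laplacian u = (\<lambda>p. partial False (partial False u) p + partial True (partial True u) p)"

definition blowup_only_at_origin :: "(nat \<Rightarrow> R2 \<Rightarrow> real) \<Rightarrow> bool" where
  "blowup_only_at_origin u \<longleftrightarrow>
     (\<exists>x :: nat \<Rightarrow> R2. (\<forall>k. x k \<in> ball 0 1) \<and> x \<longlonglongrightarrow> 0 \<and>
         filterlim (\<lambda>k. u k (x k)) at_top sequentially) \<and>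
     (\<forall>K. compact K \<and> K \<subseteq> cball 0 1 - {0} \<longrightarrow>
         (\<exists>M. \<forall>k. \<forall>y\<in>K. u k y \<le> M))"

definition spherical_harnack :: "(nat \<Rightarrow> R2 \<Rightarrow> real) \<Rightarrow> bool" where
  "spherical_harnack u \<longleftrightarrow>
     (\<exists>C>0. \<forall>k r x y. 0 < r \<and> r < 1 \<and> norm x = r \<and> norm y = r \<longrightarrow>
         \<bar>u k x - u k y\<bar> \<le> C)"

end

theory Submission
  imports Defs
begin

text \<open>
  Everything can be taken radial, with \<open>h\<^sub>k(x) = 2 - |x|\<^sup>2\<close> independent of \<open>k\<close>: it is
  decreasing in \<open>|x|\<close> and \<open>\<Delta>(log h)(0) = - 2\<close>. In the variable \<open>t = |x|\<^sup>2\<close> a radial solution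
  \<open>u(x) = v(t)\<close> satisfies \<open>(t v')' = - H e\<^sup>v\<close> with \<open>H(t) = t\<^sup>\<alpha> (2 - t) / 4\<close>, which is solvable on
  \<open>[0, 1]\<close> for each initial value \<open>v(0) = k\<close>. Since \<open>h\<close> decreases, Pohozaev's identity bounds the
  mass and gives \<open>e\<^sup>u \<le> C |x|\<^bsup>-2(\<alpha>+1)\<^esup>\<close> with \<open>C\<close> independent of \<open>k\<close>, so that the solutions stay
  bounded above away from the origin while \<open>u\<^sub>k(0) = k\<close>.
\<close>

section \<open>An integral equation regular at the origin\<close>

text \<open>For \<open>s > 0\<close> this integral is the mean of \<open>g\<close> over
  \<open>{0..s}\<close>. The substitution by \<open>\<theta>\<close> gives it a meaning at
  \<open>s = 0\<close> as well, so continuity there is that of a parameter integral.\<close>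

lemma average_continuous:
  fixes g :: "real \<Rightarrow> real"
  assumes "continuous_on {0..1} g"
  shows "continuous_on {0..1} (\<lambda>s. integral {0..1} (\<lambda>\<theta>. g (s * \<theta>)))"
proof -
  have "continuous_on ({0..1} \<times> cbox 0 1) (\<lambda>(s, \<theta>). g (s * \<theta>))"
    unfolding split_def
    by (rule continuous_on_compose2[OF assms])
       (auto intro!: continuous_intros mult_le_one)
  from integral_continuous_on_param[OF this] show ?thesis by simp
qed

text \<open>This is the integrated form of \<open>(t v')' = - g(t, v)\<close> with
  \<open>v(0) = A\<close>: one integration gives \<open>v'\<close> as minus the mean of
  \<open>g(s, v(s))\<close> over \<open>{0..t}\<close>, which removes the singularity at
  \<open>t = 0\<close>. A solution on the whole interval is a Banach fixed point.\<close>

lemma averaged_volterra_solution: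
  fixes g :: "real \<Rightarrow> real \<Rightarrow> real"
  assumes L: "L \<ge> 0"
    and cont: "continuous_on ({0..1} \<times> UNIV) (\<lambda>(s, y). g s y)"
    and Lip: "\<And>s y z. s \<in> {0..1} \<Longrightarrow> \<bar>g s y - g s z\<bar> \<le> L * \<bar>y - z\<bar>"
  obtains v where "continuous_on {0..1} v"
    "\<And>t. t \<in> {0..1} \<Longrightarrow>
       v t = A - integral {0..t} (\<lambda>s. integral {0..1} (\<lambda>\<theta>. g (s * \<theta>) (v (s * \<theta>))))"
proof -
  \<comment> \<open>The contraction factor will be \<open>L / K\<close>; adding 1 makes it less than
    1 and keeps \<open>K\<close> positive when \<open>L = 0\<close>.\<close>
  define K where "K = L + 1"
  have K: "K > 0" "L / K < 1" "0 \<le> L / K" using L by (auto simp: K_def)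
  \<comment> \<open>Bounded continuous functions here live on the whole line. Composing with this
    projection onto \<open>{0..1}\<close> extends the values of the operator to such
    functions.\<close>
  define c :: "real \<Rightarrow> real" where "c x = max 0 (min 1 x)" for x
  have c01: "c x \<in> {0..1}" for x by (auto simp: c_def)
  have contc: "continuous_on UNIV c" unfolding c_def by (intro continuous_intros)
  define I where "I w s = integral {0..1} (\<lambda>\<theta>. g (s * \<theta>) (w (s * \<theta>)))" for w :: "real \<Rightarrow> real" and s
  have contg: "continuous_on {0..1} (\<lambda>s. g s (w s))" if "continuous_on {0..1} w" for w
  proof -
    have "continuous_on {0..1} (\<lambda>s. (\<lambda>(s, y). g s y) (s, w s))"
      by (rule continuous_on_compose2[OF cont]) (use that in \<open>auto intro!: continuous_intros\<close>)
    then show ?thesis by simp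
  qed
  have contI: "continuous_on {0..1} (I w)" if "continuous_on {0..1} w" for w
    unfolding I_def by (rule average_continuous[OF contg[OF that]])
  have intI: "I w integrable_on {0..t}" if "continuous_on {0..1} w" "t \<in> {0..1}" for w t
    using that by (intro integrable_continuous_real continuous_on_subset[OF contI]) auto
  \<comment> \<open>The exponential weight turns the Volterra operator into a contraction on all of \<open>[0, 1]\<close>.\<close>
  define W where "W \<phi> t = exp (K * t) * apply_bcontfun \<phi> t" for \<phi> :: "real \<Rightarrow>\<^sub>C real" and t
  have contW: "continuous_on X (W \<phi>)" for X \<phi>
    unfolding W_def by (intro continuous_intros continuous_on_apply_bcontfun)
  \<comment> \<open>With \<open>v = W \<phi>\<close>, the integral equation for \<open>v\<close>
    reads \<open>\<phi> = J \<phi>\<close> on \<open>{0..1}\<close>.\<close>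
  define J where "J \<phi> t = exp (- K * t) * (A - integral {0..t} (I (W \<phi>)))" for \<phi> t
  have contJ: "continuous_on {0..1} (J \<phi>)" for \<phi>
    unfolding J_def using contW
    by (intro continuous_intros indefinite_integral_continuous_1 intI) auto
  have Jb: "(\<lambda>x. J \<phi> (c x)) \<in> bcontfun" for \<phi>
  proof -
    have "continuous_on UNIV (\<lambda>x. J \<phi> (c x))"
      by (rule continuous_on_compose2[OF contJ contc]) (use c01 in auto)
    moreover have "bounded (range (\<lambda>x. J \<phi> (c x)))"
    proof (rule bounded_subset)
      show "bounded (J \<phi> ` {0..1})"
        by (intro compact_imp_bounded compact_continuous_image contJ) auto
    qed (use c01 in auto)
    ultimately show ?thesis by (simp add: bcontfun_def)
  qed
  define T where "T \<phi> = Bcontfun (\<lambda>x. J \<phi> (c x))" for \<phi>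
  have T: "apply_bcontfun (T \<phi>) x = J \<phi> (c x)" for \<phi> x
    unfolding T_def using Jb by (simp add: Bcontfun_inverse)
  have contr: "\<bar>J \<phi> t - J \<psi> t\<bar> \<le> L / K * dist \<phi> \<psi>" if t: "t \<in> {0..1}" for \<phi> \<psi> t
  proof -
    let ?d = "dist \<phi> \<psi>"
    have gd: "\<bar>g s (W \<phi> s) - g s (W \<psi> s)\<bar> \<le> L * exp (K * s) * ?d" if "s \<in> {0..1}" for s
    proof -
      have "\<bar>W \<phi> s - W \<psi> s\<bar> = exp (K * s) * \<bar>apply_bcontfun \<phi> s - apply_bcontfun \<psi> s\<bar>"
        by (simp add: W_def abs_mult flip: right_diff_distrib)
      also have "\<dots> \<le> exp (K * s) * ?d"
        using dist_bounded[of \<phi> s \<psi>] by (intro mult_left_mono) (auto simp: dist_real_def)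
      finally show ?thesis
        using Lip[OF that, of "W \<phi> s" "W \<psi> s"] L
        by (smt (verit, best) mult.assoc mult_left_mono)
    qed
    \<comment> \<open>Averaging does not spoil the pointwise bound: it looks only at arguments
      \<open>s * \<theta> \<le> s\<close>, where the increasing weight is at most
      \<open>exp (K * s)\<close>.\<close>
    have Id: "\<bar>I (W \<phi>) s - I (W \<psi>) s\<bar> \<le> L * exp (K * s) * ?d" if s: "s \<in> {0..1}" for s
    proof -
      have int: "(\<lambda>\<theta>. g (s * \<theta>) (W \<eta> (s * \<theta>))) integrable_on {0..1}" for \<eta>
        by (intro integrable_continuous_real continuous_on_compose2[OF contg[OF contW]])
           (use s in \<open>auto intro!: continuous_intros mult_le_one\<close>)
      have "\<bar>I (W \<phi>) s - I (W \<psi>) s\<bar> =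
          \<bar>integral {0..1} (\<lambda>\<theta>. g (s * \<theta>) (W \<phi> (s * \<theta>)) - g (s * \<theta>) (W \<psi> (s * \<theta>)))\<bar>"
        unfolding I_def by (subst integral_diff[OF int int]) simp
      also have "\<dots> \<le> integral {0..1} (\<lambda>\<theta>::real. L * exp (K * s) * ?d)"
        unfolding real_norm_def[symmetric]
      proof (rule integral_norm_bound_integral)
        fix \<theta> :: real assume th: "\<theta> \<in> {0..1}"
        have st: "s * \<theta> \<in> {0..1}" "s * \<theta> \<le> s"
          using s th by (auto intro: mult_le_one mult_left_le)
        have "L * exp (K * (s * \<theta>)) * ?d \<le> L * exp (K * s) * ?d"
          using L K st by (intro mult_right_mono mult_left_mono) auto
        with gd[OF st(1)] show "norm (g (s * \<theta>) (W \<phi> (s * \<theta>)) - g (s * \<theta>) (W \<psi> (s * \<theta>))) \<le> L * exp (K * s) * ?d"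
          by simp
      qed (auto intro!: integrable_diff int)
      finally show ?thesis by simp
    qed
    \<comment> \<open>Integrating the weight gains the factor \<open>1 / K\<close>; the remaining
      \<open>exp (K * t)\<close> is absorbed by the factor in \<open>J\<close>.\<close>
    have ex: "((\<lambda>s. L * exp (K * s) * ?d) has_integral (L / K * ?d * exp (K * t) - L / K * ?d * exp (K * 0))) {0..t}"
      by (rule fundamental_theorem_of_calculus)
         (use t K in \<open>auto intro!: derivative_eq_intros simp flip: has_real_derivative_iff_has_vector_derivative\<close>)
    have "\<bar>integral {0..t} (I (W \<psi>)) - integral {0..t} (I (W \<phi>))\<bar> =
        \<bar>integral {0..t} (\<lambda>s. I (W \<psi>) s - I (W \<phi>) s)\<bar>"
      by (subst integral_diff) (auto intro!: intI contW t)
    also have "\<dots> \<le> integral {0..t} (\<lambda>s. L * exp (K * s) * ?d)"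
      unfolding real_norm_def[symmetric]
    proof (rule integral_norm_bound_integral)
      fix s assume "s \<in> {0..t}"
      with Id[of s] t show "norm (I (W \<psi>) s - I (W \<phi>) s) \<le> L * exp (K * s) * ?d" by auto
    qed (use ex in \<open>auto intro!: integrable_diff intI contW t\<close>)
    also have "\<dots> \<le> L / K * ?d * exp (K * t)"
      unfolding integral_unique[OF ex] using mult_nonneg_nonneg[OF K(3), of ?d] by simp
    finally have *: "\<bar>integral {0..t} (I (W \<psi>)) - integral {0..t} (I (W \<phi>))\<bar> \<le> L / K * ?d * exp (K * t)" .
    have "\<bar>J \<phi> t - J \<psi> t\<bar> = exp (- K * t) * \<bar>integral {0..t} (I (W \<psi>)) - integral {0..t} (I (W \<phi>))\<bar>"
      by (simp add: J_def abs_mult flip: right_diff_distrib)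
    also have "\<dots> \<le> exp (- K * t) * (L / K * ?d * exp (K * t))"
      using * by (intro mult_left_mono) auto
    also have "\<dots> = L / K * ?d" by (simp add: exp_minus)
    finally show ?thesis .
  qed
  have "\<exists>!\<phi>. T \<phi> = \<phi>"
  proof (rule banach_fix_type[OF K(3,2)], intro allI)
    fix \<phi> \<psi> show "dist (T \<phi>) (T \<psi>) \<le> L / K * dist \<phi> \<psi>"
      by (rule dist_bound) (use contr[OF c01] in \<open>simp add: T dist_real_def\<close>)
  qed
  then obtain \<phi> where \<phi>: "T \<phi> = \<phi>" by blast
  show ?thesis
  proof
    show "continuous_on {0..1} (W \<phi>)" by (rule contW)
    fix t :: real assume t: "t \<in> {0..1}"
    have "apply_bcontfun \<phi> t = J \<phi> t" using T[of \<phi> t] t by (simp add: \<phi> c_def)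
    then have "W \<phi> t = A - integral {0..t} (I (W \<phi>))"
      by (simp add: W_def J_def exp_minus)
    then show "W \<phi> t = A - integral {0..t} (\<lambda>s. integral {0..1} (\<lambda>\<theta>. g (s * \<theta>) (W \<phi> (s * \<theta>))))"
      by (simp only: I_def[abs_def])
  qed
qed

section \<open>Integrals of radial functions over the disk\<close>

text \<open>For \<open>0 \<le> a < 1\<close> the part of the disk where \<open>|x|^2 > a\<close> is
  an annulus of area \<open>pi * (1 - a)\<close>, which is linear in \<open>a\<close>. Hence
  \<open>|x|^2\<close> has constant density \<open>pi\<close> on \<open>{0..1}\<close>; the
  half-lines \<open>{a<..}\<close> determine these finite measures.\<close>

lemma distr_norm_square_ball:
  "distr (density lborel (indicator (ball 0 1))) borel (\<lambda>x::R2. (norm x)\<^sup>2) =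
   density lborel (\<lambda>t::real. ennreal pi * indicator {0..1} t)"
  (is "?M = ?N")
proof (rule measure_eqI_lessThan)
  fix a :: real
  have ind: "indicator (ball 0 1) \<in> borel_measurable (borel :: R2 measure)"
    by (intro borel_measurable_indicator borel_open) auto
  have "emeasure ?M {a<..} =
      emeasure (density lborel (indicator (ball 0 1))) {x::R2. a < (norm x)\<^sup>2}"
    by (subst emeasure_distr) (auto simp: vimage_def)
  also have "\<dots> = (\<integral>\<^sup>+x. indicator (ball 0 1 \<inter> {x::R2. a < (norm x)\<^sup>2}) x \<partial>lborel)"
  proof (subst emeasure_density)
    show "(\<integral>\<^sup>+x. indicator (ball 0 1) x * indicator {x::R2. a < (norm x)\<^sup>2} x \<partial>lborel) =
        (\<integral>\<^sup>+x. indicator (ball 0 1 \<inter> {x::R2. a < (norm x)\<^sup>2}) x \<partial>lborel)"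
      by (rule nn_integral_cong) (simp add: indicator_inter_arith)
  qed (use ind in auto)
  also have "\<dots> = emeasure lborel (ball 0 1 \<inter> {x::R2. a < (norm x)\<^sup>2})"
    by (rule nn_integral_indicator) simp
  finally have M: "emeasure ?M {a<..} = emeasure lborel (ball 0 1 \<inter> {x::R2. a < (norm x)\<^sup>2})" .
  note M
  also have "\<dots> = ennreal pi * emeasure lborel ({0..1} \<inter> {a<..})"
  proof -
    consider "a < 0" | "0 \<le> a" "a < 1" | "1 \<le> a" by linarith
    then show ?thesis
    proof cases
      case 1
      then have "ball 0 1 \<inter> {x::R2. a < (norm x)\<^sup>2} = ball 0 1" "{0..1} \<inter> {a<..} = {0..1}"
        by (auto intro: less_le_trans)
      then show ?thesis by (simp add: emeasure_ball unit_ball_vol_2)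
    next
      case 2
      have eq: "ball 0 1 \<inter> {x::R2. a < (norm x)\<^sup>2} = ball 0 1 - cball 0 (sqrt a)"
        "{0..1} \<inter> {a<..} = {a<..1}"
        using 2 by (auto simp: real_le_lsqrt real_sqrt_le_iff not_le intro: real_less_lsqrt sqrt_le_D)
           (metis abs_norm_cancel not_le real_sqrt_abs real_sqrt_le_iff)+
      have "emeasure lborel (ball (0::R2) 1 - cball 0 (sqrt a)) =
          emeasure lborel (ball (0::R2) 1) - emeasure lborel (cball (0::R2) (sqrt a))"
        using 2 by (intro emeasure_Diff) (auto simp: emeasure_cball subset_iff intro: le_less_trans)
      also have "\<dots> = ennreal (pi - pi * a)"
        using 2 by (simp add: emeasure_ball emeasure_cball unit_ball_vol_2 ennreal_minus)
      finally show ?thesis using 2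
        by (simp add: eq ennreal_mult[symmetric] right_diff_distrib)
    next
      case 3
      have "\<not> a < (norm x)\<^sup>2" if "norm x < 1" for x :: R2
        using power_le_one[OF norm_ge_zero, of x 2] that 3 by simp
      then have "ball 0 1 \<inter> {x::R2. a < (norm x)\<^sup>2} = {}" "{0..1} \<inter> {a<..} = {}"
        using 3 by auto
      then show ?thesis by simp
    qed
  qed
  also have "\<dots> = emeasure ?N {a<..}"
  proof -
    have "emeasure ?N {a<..} = (\<integral>\<^sup>+t. ennreal pi * indicator ({0..1} \<inter> {a<..}) t \<partial>lborel)"
    proof (subst emeasure_density)
      show "(\<integral>\<^sup>+t. ennreal pi * indicator {0..1} t * indicator {a<..} t \<partial>lborel) =
          (\<integral>\<^sup>+t. ennreal pi * indicator ({0..1} \<inter> {a<..}) t \<partial>lborel)"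
        by (rule nn_integral_cong) (simp add: indicator_inter_arith mult.assoc)
    qed auto
    also have "\<dots> = ennreal pi * emeasure lborel ({0..1} \<inter> {a<..})"
      by (rule nn_integral_cmult_indicator) simp
    finally show ?thesis by (rule sym)
  qed
  finally show *: "emeasure ?M {a<..} = emeasure ?N {a<..}" .
  have "emeasure ?M {a<..} \<le> emeasure lborel (ball (0::R2) 1)"
    unfolding M by (rule emeasure_mono) auto
  also have "\<dots> < \<infinity>" by (simp add: emeasure_ball)
  finally show "emeasure ?M {a<..} < \<infinity>" .
qed auto

text \<open>The image measure of the disk under \<open>|x|^2\<close> takes the place of polar
  coordinates, turning the integral over the disk into one over \<open>{0..1}\<close>.\<close>

lemma radial_integral_unit_disk:
  fixes F :: "real \<Rightarrow> real"
  assumes F: "continuous_on {0..1} F"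
  shows "((\<lambda>x::R2. F ((norm x)\<^sup>2)) has_integral pi * integral {0..1} F) (ball 0 1)"
proof -
  \<comment> \<open>\<open>F\<close> is controlled on \<open>{0..1}\<close> only; cutting it off
    there gives a Borel function on the line, as the transfer to the image measure requires.\<close>
  define G where "G t = indicator {0..1} t * F t" for t
  have Gint: "integrable lborel G"
    using borel_integrable_compact[OF _ F] by (auto simp: G_def[abs_def])
  then have meas[measurable]: "G \<in> borel_measurable borel" by simp
  have "set_integrable lborel (cball 0 1) (\<lambda>x::R2. F ((norm x)\<^sup>2))"
    unfolding set_integrable_def
    by (intro borel_integrable_compact continuous_on_compose2[OF F])
       (auto intro!: continuous_intros power_le_one)
  then have si: "set_integrable lborel (ball 0 1) (\<lambda>x::R2. F ((norm x)\<^sup>2))"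
    by (rule set_integrable_subset) auto
  have "(LINT x:ball 0 1|lborel. F ((norm (x::R2))\<^sup>2)) = (LINT x|density lborel (indicator (ball 0 1)). G ((norm (x::R2))\<^sup>2))"
    unfolding set_lebesgue_integral_def ennreal_indicator[symmetric]
  proof (subst integral_density)
    show "(\<lambda>x::R2. G ((norm x)\<^sup>2)) \<in> borel_measurable lborel"
      using measurable_compose[OF _ meas, of "\<lambda>x::R2. (norm x)\<^sup>2" borel] by simp
    show "indicat_real (ball (0::R2) 1) \<in> borel_measurable lborel"
      unfolding measurable_lborel1 by (intro borel_measurable_indicator borel_open) auto
  qed (auto intro!: Bochner_Integration.integral_cong simp: G_def indicator_def power_le_one)
  also have "\<dots> = (LINT t|distr (density lborel (indicator (ball 0 1))) borel (\<lambda>x::R2. (norm x)\<^sup>2). G t)"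
    by (subst integral_distr) auto
  also have "\<dots> = (LINT t|density lborel (\<lambda>t. ennreal (pi * indicator {0..1} t)). G t)"
    unfolding distr_norm_square_ball by (simp add: ennreal_mult ennreal_indicator)
  also have "\<dots> = (LINT t|lborel. pi * G t)"
  proof (subst integral_density)
    show "(LINT t|lborel. (pi * indicator {0..1} t) *\<^sub>R G t) = (LINT t|lborel. pi * G t)"
      by (rule Bochner_Integration.integral_cong) (auto simp: G_def indicator_def)
  qed auto
  also have "\<dots> = pi * (LINT t:{0..1}|lborel. F t)"
    by (simp add: G_def[abs_def] set_lebesgue_integral_def)
  also have "(LINT t:{0..1}|lborel. F t) = integral {0..1} F"
    using Gint by (intro set_borel_integral_eq_integral) (simp add: G_def[abs_def] set_integrable_def)
  finally show ?thesis
    using set_borel_integral_eq_integral[OF si] by (simp add: has_integral_iff)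
qed

section \<open>Solving the radial equation\<close>

lemma DERIV_within_chain:
  assumes "(f has_field_derivative D) (at (g x) within T)" "g ` S \<subseteq> T"
    "(g has_field_derivative E) (at x within S)"
  shows "((\<lambda>x. f (g x)) has_field_derivative D * E) (at x within S)"
  using DERIV_image_chain[OF DERIV_subset[OF assms(1,2)] assms(3)] by (simp add: o_def)

text \<open>The last conclusion is \<open>(t v')' = - H e^v\<close>, degenerate at
  \<open>t = 0\<close>. Regularity up to that point comes from writing \<open>v'\<close> as minus
  the integral of \<open>F (t * \<theta>)\<close> over \<open>\<theta>\<close>, where
  \<open>F = H e^v\<close>: this can be differentiated under the integral sign.\<close>

lemma radial_liouville_solution:
  fixes H H' :: "real \<Rightarrow> real"
  assumes dH: "\<And>t. t \<in> {0..1} \<Longrightarrow> (H has_real_derivative H' t) (at t within {0..1})"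
    and cH': "continuous_on {0..1} H'"
    and H0: "\<And>t. t \<in> {0..1} \<Longrightarrow> 0 \<le> H t"
  obtains v v1 v2 where "v 0 = A" "continuous_on {0..1} v1" "continuous_on {0..1} v2"
    "\<And>t. t \<in> {0..1} \<Longrightarrow> (v has_real_derivative v1 t) (at t within {0..1})"
    "\<And>t. t \<in> {0..1} \<Longrightarrow> (v1 has_real_derivative v2 t) (at t within {0..1})"
    "\<And>t. t \<in> {0..1} \<Longrightarrow> v1 t + t * v2 t = - H t * exp (v t)"
proof -
  have cH: "continuous_on {0..1} H" by (rule DERIV_continuous_on[OF dH])
  obtain M where M: "\<And>t. t \<in> {0..1} \<Longrightarrow> H t \<le> M"
    using continuous_attains_sup[OF compact_Icc _ cH] by force
  have M0: "M \<ge> 0" using H0[of 0] M[of 0] by simp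
  \<comment> \<open>The truncation makes the nonlinearity globally Lipschitz; it is inactive on the solution,
    which never exceeds its initial value.\<close>
  define g where "g s y = H s * exp (min y A)" for s y
  have lip1: "\<bar>exp (min y A) - exp (min z A)\<bar> \<le> exp A * \<bar>y - z\<bar>" if "y \<le> z" for y z
  proof -
    let ?a = "min y A" and ?b = "min z A"
    have ab: "?a \<le> ?b" "?b - ?a \<le> z - y" using that by auto
    have "exp ?b - exp ?a = exp ?b * (1 - exp (?a - ?b))" by (simp add: algebra_simps flip: exp_add)
    also have "\<dots> \<le> exp ?b * (?b - ?a)"
    proof (rule mult_left_mono)
      show "1 - exp (?a - ?b) \<le> ?b - ?a" using exp_ge_add_one_self[of "?a - ?b"] by linarith
    qed simp
    also have "\<dots> \<le> exp A * (z - y)"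
      using ab by (intro mult_mono) auto
    finally show ?thesis using that ab(1) by (simp add: abs_if)
  qed
  have lip: "\<bar>exp (min y A) - exp (min z A)\<bar> \<le> exp A * \<bar>y - z\<bar>" for y z
    using lip1[of y z] lip1[of z y] by (cases "y \<le> z") (auto simp: abs_minus_commute)
  obtain v where cv: "continuous_on {0..1} v" and v: "\<And>t. t \<in> {0..1} \<Longrightarrow>
       v t = A - integral {0..t} (\<lambda>s. integral {0..1} (\<lambda>\<theta>. g (s * \<theta>) (v (s * \<theta>))))"
  proof (rule averaged_volterra_solution[of "M * exp A" g A])
    show "continuous_on ({0..1} \<times> UNIV) (\<lambda>(s, y). g s y)"
      unfolding g_def split_def
      by (intro continuous_intros continuous_on_compose2[OF cH]) auto
    fix s y z :: real assume s: "s \<in> {0..1}"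
    have "\<bar>g s y - g s z\<bar> = H s * \<bar>exp (min y A) - exp (min z A)\<bar>"
      using H0[OF s] by (simp add: g_def abs_mult flip: right_diff_distrib)
    also have "\<dots> \<le> M * (exp A * \<bar>y - z\<bar>)"
      by (intro mult_mono lip M[OF s] M0) auto
    finally show "\<bar>g s y - g s z\<bar> \<le> M * exp A * \<bar>y - z\<bar>" by (simp add: mult.assoc)
  qed (use M0 in auto)
  have st: "s * \<theta> \<in> {0..1}" if "s \<in> {0..1}" "\<theta> \<in> {0..1}" for s \<theta> :: real
    using that by (auto intro: mult_le_one)
  have vA: "v t \<le> A" if t: "t \<in> {0..1}" for t
  proof -
    \<comment> \<open>The integral of a non-integrable function is 0 by convention, so the sign of
      the integrand decides in every case.\<close>
    have nn: "0 \<le> integral S f" if "\<And>x. x \<in> S \<Longrightarrow> 0 \<le> f x" for S and f :: "real \<Rightarrow> real"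
      using that by (cases "f integrable_on S") (auto intro: Henstock_Kurzweil_Integration.integral_nonneg simp: not_integrable_integral)
    have "0 \<le> integral {0..t} (\<lambda>s. integral {0..1} (\<lambda>\<theta>. g (s * \<theta>) (v (s * \<theta>))))"
      unfolding g_def
      by (intro nn mult_nonneg_nonneg H0 st) (use t in auto)
    then show ?thesis using v[OF t] by simp
  qed
  define F where "F s = H s * exp (v s)" for s
  have gF: "g s (v s) = F s" if "s \<in> {0..1}" for s
    using vA[OF that] by (simp add: g_def F_def)
  have cF: "continuous_on {0..1} F" unfolding F_def by (intro continuous_intros cH cv)
  define v1 where "v1 t = - integral {0..1} (\<lambda>\<theta>. F (t * \<theta>))" for t
  have cv1: "continuous_on {0..1} v1"
    unfolding v1_def by (intro continuous_intros average_continuous cF)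
  have dv: "(v has_real_derivative v1 t) (at t within {0..1})" if t: "t \<in> {0..1}" for t
  proof -
    have D: "((\<lambda>t. A - integral {0..t} (\<lambda>s. - v1 s)) has_real_derivative v1 t) (at t within {0..1})"
      using t cv1 by (auto intro!: derivative_eq_intros integral_has_real_derivative continuous_intros)
    have "v x = A - integral {0..x} (\<lambda>s. - v1 s)" if "x \<in> {0..1}" for x
    proof -
      have "integral {0..x} (\<lambda>s. integral {0..1} (\<lambda>\<theta>. g (s * \<theta>) (v (s * \<theta>)))) = integral {0..x} (\<lambda>s. - v1 s)"
        unfolding v1_def minus_minus
        by (intro Henstock_Kurzweil_Integration.integral_cong gF st) (use that in auto)
      then show ?thesis using v[OF that] by simp
    qed
    from has_field_derivative_transform_within[OF D zero_less_one t this[symmetric]]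
    show ?thesis .
  qed
  define F' where "F' s = H' s * exp (v s) + H s * (exp (v s) * v1 s)" for s
  have dF: "(F has_real_derivative F' s) (at s within {0..1})" if "s \<in> {0..1}" for s
    unfolding F_def F'_def by (auto intro!: derivative_eq_intros dH dv that)
  have cF': "continuous_on {0..1} F'"
    unfolding F'_def by (intro continuous_intros cH cH' cv cv1)
  have cI: "continuous_on ({0..1} \<times> cbox 0 1) (\<lambda>(s, \<theta>). \<theta> * F' (s * \<theta>))"
    unfolding split_def
    by (intro continuous_intros continuous_on_compose2[OF cF']) (auto intro: mult_le_one)
  \<comment> \<open>This is \<open>v1\<close> differentiated under the integral sign; the factor
    \<open>\<theta>\<close> is the inner derivative of \<open>t * \<theta>\<close>.\<close>
  define v2 where "v2 t = - integral {0..1} (\<lambda>\<theta>. \<theta> * F' (t * \<theta>))" for t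
  have cv2: "continuous_on {0..1} v2"
    using integral_continuous_on_param[OF cI] unfolding v2_def by (intro continuous_intros) simp
  have cFt: "continuous_on {0..1} (\<lambda>\<theta>. F (t * \<theta>))" "continuous_on {0..1} (\<lambda>\<theta>. \<theta> * F' (t * \<theta>))"
    if "t \<in> {0..1}" for t
    by (intro continuous_intros continuous_on_compose2[OF cF] continuous_on_compose2[OF cF'];
        use that in \<open>auto intro: mult_le_one\<close>)+
  have dv1: "(v1 has_real_derivative v2 t) (at t within {0..1})" if t: "t \<in> {0..1}" for t
  proof -
    have "((\<lambda>x. integral (cbox 0 1) (\<lambda>\<theta>. F (x * \<theta>))) has_real_derivative
        integral (cbox 0 1) (\<lambda>\<theta>. \<theta> * F' (t * \<theta>))) (at t within {0..1})"
    proof (rule leibniz_rule_field_derivative[OF _ _ cI t])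
      fix x \<theta> :: real assume x: "x \<in> {0..1}" "\<theta> \<in> cbox 0 1"
      have "((\<lambda>x. F (x * \<theta>)) has_real_derivative F' (x * \<theta>) * \<theta>) (at x within {0..1})"
        by (rule DERIV_within_chain[of F _ "\<lambda>x. x * \<theta>", OF dF[OF st]])
           (use x in \<open>auto intro!: derivative_eq_intros intro: mult_le_one\<close>)
      then show "((\<lambda>x. F (x * \<theta>)) has_real_derivative \<theta> * F' (x * \<theta>)) (at x within {0..1})"
        by (simp add: mult.commute)
    next
      fix x :: real assume "x \<in> {0..1}"
      then show "(\<lambda>\<theta>. F (x * \<theta>)) integrable_on cbox 0 1"
        using integrable_continuous_real[OF cFt(1)] by simp
    qed auto
    then show ?thesis unfolding v1_def v2_def by (auto intro!: derivative_eq_intros)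
  qed
  have eq: "v1 t + t * v2 t = - H t * exp (v t)" if t: "t \<in> {0..1}" for t
  proof -
    \<comment> \<open>The integrand is the derivative of \<open>\<theta> * F (t * \<theta>)\<close>
      in \<open>\<theta>\<close>, and its two summands integrate to \<open>- v1 t\<close> and
      \<open>- t * v2 t\<close>. No division by \<open>t\<close> occurs, so \<open>t = 0\<close> is
      covered.\<close>
    have "((\<lambda>\<theta>. F (t * \<theta>) + t * (\<theta> * F' (t * \<theta>))) has_integral 1 * F (t * 1) - 0 * F (t * 0)) {0..1}"
    proof (rule fundamental_theorem_of_calculus)
      fix \<theta> :: real assume th: "\<theta> \<in> {0..1}"
      have "((\<lambda>\<theta>. F (t * \<theta>)) has_real_derivative F' (t * \<theta>) * t) (at \<theta> within {0..1})"
        by (rule DERIV_within_chain[of F _ "\<lambda>\<theta>. t * \<theta>", OF dF[OF st]])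
           (use t th in \<open>auto intro!: derivative_eq_intros intro: mult_le_one\<close>)
      then show "((\<lambda>\<theta>. \<theta> * F (t * \<theta>)) has_vector_derivative F (t * \<theta>) + t * (\<theta> * F' (t * \<theta>))) (at \<theta> within {0..1})"
        unfolding has_real_derivative_iff_has_vector_derivative[symmetric]
        by (auto intro!: derivative_eq_intros)
    qed auto
    then have "F t = integral {0..1} (\<lambda>\<theta>. F (t * \<theta>) + t * (\<theta> * F' (t * \<theta>)))"
      by (simp add: has_integral_iff)
    also have "\<dots> = integral {0..1} (\<lambda>\<theta>. F (t * \<theta>)) + integral {0..1} (\<lambda>\<theta>. t * (\<theta> * F' (t * \<theta>)))"
      by (intro Henstock_Kurzweil_Integration.integral_add integrable_continuous_real cFt continuous_intros t)
    also have "\<dots> = - v1 t - t * v2 t" by (simp add: v1_def v2_def)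
    finally show ?thesis by (simp add: F_def)
  qed
  show ?thesis
    by (rule that[OF _ cv1 cv2 dv dv1 eq]) (use v[of 0] in auto)
qed

section \<open>Pohozaev bounds independent of the initial value\<close>

text \<open>The growth condition says that \<open>H(t) / t^(n-1)\<close> does not increase for
  \<open>t > 0\<close>. It makes the Pohozaev quantity nonincreasing from its value 0, so that
  \<open>t H e^v \<le> n m - m^2 / 2\<close> with \<open>m = - t v'\<close>. Maximising the right
  side over \<open>m\<close> gives the pointwise bound; its nonnegativity at \<open>t = 1\<close>
  bounds the mass \<open>m(1)\<close>.\<close>

lemma pohozaev_bounds:
  fixes H H' v v1 v2 :: "real \<Rightarrow> real" and n :: real
  assumes dH: "\<And>t. t \<in> {0..1} \<Longrightarrow> (H has_real_derivative H' t) (at t within {0..1})"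
    and H0: "\<And>t. t \<in> {0..1} \<Longrightarrow> 0 \<le> H t"
    and H': "\<And>t. t \<in> {0..1} \<Longrightarrow> t * H' t \<le> (n - 1) * H t"
    and n: "n > 0"
    and dv: "\<And>t. t \<in> {0..1} \<Longrightarrow> (v has_real_derivative v1 t) (at t within {0..1})"
    and dv1: "\<And>t. t \<in> {0..1} \<Longrightarrow> (v1 has_real_derivative v2 t) (at t within {0..1})"
    and eq: "\<And>t. t \<in> {0..1} \<Longrightarrow> v1 t + t * v2 t = - H t * exp (v t)"
  shows "t \<in> {0..1} \<Longrightarrow> t * H t * exp (v t) \<le> n\<^sup>2 / 2"
    and "integral {0..1} (\<lambda>t. H t * exp (v t)) \<le> 2 * n"
proof -
  \<comment> \<open>The equation makes this the mass of \<open>H e^v\<close> on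
    \<open>{0..t}\<close>; it vanishes at 0.\<close>
  define m where "m t = - t * v1 t" for t
  have dm: "(m has_real_derivative H t * exp (v t)) (at t within {0..1})" if "t \<in> {0..1}" for t
    unfolding m_def using eq[OF that] by (auto intro!: derivative_eq_intros dv1 that simp: algebra_simps)
  \<comment> \<open>Pohozaev's identity: in the variable \<open>log t\<close> this is the energy of the autonomous equation
    when \<open>H\<close> is a power.\<close>
  define \<Phi> where "\<Phi> t = t * (H t * exp (v t)) - n * m t + (m t)\<^sup>2 / 2" for t
  have d\<Phi>: "(\<Phi> has_real_derivative (t * H' t - (n - 1) * H t) * exp (v t)) (at t within {0..1})"
    if t: "t \<in> {0..1}" for t
  proof -
    have "(\<Phi> has_real_derivative t * (H' t * exp (v t) + exp (v t) * v1 t * H t) + 1 * (H t * exp (v t))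
        - n * (H t * exp (v t)) + m t * (H t * exp (v t))) (at t within {0..1})"
      unfolding \<Phi>_def by (auto intro!: derivative_eq_intros dm dH dv t)
    \<comment> \<open>Since \<open>t * v1 t = - m t\<close>, the term from differentiating
      \<open>exp (v t)\<close> cancels the one from \<open>m^2 / 2\<close>.\<close>
    then show ?thesis by (simp add: m_def algebra_simps)
  qed
  have \<Phi>0: "\<Phi> t \<le> 0" if t: "t \<in> {0..1}" for t
  proof (cases "t = 0")
    case False
    have "\<Phi> t \<le> \<Phi> 0"
    proof (rule DERIV_nonpos_imp_decreasing_open[of 0 t \<Phi>])
      show "continuous_on {0..t} \<Phi>"
        by (rule continuous_on_subset[OF DERIV_continuous_on[OF d\<Phi>]]) (use t in auto)
      fix x assume x: "0 < x" "x < t"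
      with t d\<Phi>[of x] have "DERIV \<Phi> x :> (x * H' x - (n - 1) * H x) * exp (v x)"
        by (simp add: at_within_Icc_at)
      moreover have "(x * H' x - (n - 1) * H x) * exp (v x) \<le> 0"
        using H'[of x] x t by (intro mult_nonpos_nonneg) auto
      ultimately show "\<exists>y. DERIV \<Phi> x :> y \<and> y \<le> 0" by blast
    qed (use False t in auto)
    then show ?thesis by (simp add: \<Phi>_def m_def)
  qed (simp add: \<Phi>_def m_def)
  show "t * H t * exp (v t) \<le> n\<^sup>2 / 2" if t: "t \<in> {0..1}"
  proof -
    have "0 \<le> (m t - n)\<^sup>2" by simp
    with \<Phi>0[OF t] show ?thesis
      by (simp add: \<Phi>_def power2_eq_square algebra_simps)
  qed
  have "m 1 * (m 1 - 2 * n) \<le> 0"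
  proof -
    have "0 \<le> H 1 * exp (v 1)" using H0[of 1] by simp
    moreover have "H 1 * exp (v 1) - n * m 1 + (m 1)\<^sup>2 / 2 \<le> 0" using \<Phi>0[of 1] by (simp add: \<Phi>_def)
    ultimately have "(m 1)\<^sup>2 \<le> 2 * (n * m 1)" by linarith
    then show ?thesis by (simp add: power2_eq_square algebra_simps)
  qed
  then have m1: "m 1 \<le> 2 * n"
    using n by (auto simp: mult_le_0_iff)
  have "((\<lambda>t. H t * exp (v t)) has_integral m 1 - m 0) {0..1}"
    by (rule fundamental_theorem_of_calculus)
       (use dm in \<open>auto simp flip: has_real_derivative_iff_has_vector_derivative\<close>)
  then have "integral {0..1} (\<lambda>t. H t * exp (v t)) = m 1"
    by (simp add: has_integral_iff m_def)
  with m1 show "integral {0..1} (\<lambda>t. H t * exp (v t)) \<le> 2 * n" by simp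
qed

section \<open>Partial derivatives of radial functions\<close>

text \<open>Together with \<open>upd\<close>, this merges the two cases of \<open>partial\<close>:
  \<open>upd b p\<close> parametrises the line through \<open>p\<close> in direction
  \<open>b\<close>, and \<open>coord b p\<close> is the parameter of \<open>p\<close> on it.\<close>

definition coord :: "bool \<Rightarrow> R2 \<Rightarrow> real" where
  "coord b p = (if b then snd p else fst p)"

definition upd :: "bool \<Rightarrow> R2 \<Rightarrow> real \<Rightarrow> R2" where
  "upd b p t = (if b then (fst p, t) else (t, snd p))"

lemma upd_coord [simp]: "upd b p (coord b p) = p"
  by (simp add: upd_def coord_def)

lemma coord_upd: "coord a (upd b p t) = (if a = b then t else coord a p)"
  by (auto simp: upd_def coord_def)

lemma continuous_on_coord [continuous_intros]: "continuous_on S (coord b)"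
  unfolding coord_def by (cases b) (auto intro!: continuous_intros)

lemma continuous_on_upd: "continuous_on S (upd b p)"
  unfolding upd_def by (cases b) (auto intro!: continuous_intros)

lemma norm_square_coord: "(norm p)\<^sup>2 = (coord b p)\<^sup>2 + (coord (\<not> b) p)\<^sup>2"
  for p :: R2
  by (cases p) (auto simp: coord_def norm_Pair)

text \<open>A derivative along the coordinate line serves twice, because the value given by
  \<open>deriv\<close> does not by itself certify that the derivative exists.\<close>

lemma
  assumes "((\<lambda>t. f (upd b p t)) has_real_derivative D) (at (coord b p))"
  shows partial_eqI: "partial b f p = D" and has_partialI: "has_partial b f p"
  using DERIV_imp_deriv[OF assms] assms unfolding partial_def has_partial_def
  by (cases p; cases b; auto simp: upd_def coord_def real_differentiable_def)+

text \<open>Formulas for first partial derivatives are known on the open disk only; locality allows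
  them to be differentiated again.\<close>

lemma has_real_derivative_upd_cong_open:
  assumes "((\<lambda>t. f (upd b p t)) has_real_derivative D) (at (coord b p))"
    and "open U" "p \<in> U" "\<And>q. q \<in> U \<Longrightarrow> g q = f q"
  shows "((\<lambda>t. g (upd b p t)) has_real_derivative D) (at (coord b p))"
proof (rule has_field_derivative_transform_within_open[OF assms(1)])
  show "open (upd b p -` U)"
    by (rule open_vimage[OF assms(2) continuous_on_upd])
qed (use assms in auto)

text \<open>At the centre of the disk \<open>W\<close> has only a one-sided derivative. This
  suffices for the chain rule, since the squared norm never leaves \<open>{0..}\<close>.\<close>

lemma has_real_derivative_upd_radial:
  assumes "(W has_real_derivative W') (at ((norm p)\<^sup>2) within {0..1})" "norm p < 1"
  shows "((\<lambda>t. W ((norm (upd b p t))\<^sup>2)) has_real_derivative W' * (2 * coord b p)) (at (coord b p))"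
proof -
  have "(norm p)\<^sup>2 < 1" using assms(2) by (simp add: power_less_one_iff abs_square_less_1)
  \<comment> \<open>Strictly inside the disk the end point 1 is not seen, so the range condition
    reduces to nonnegativity.\<close>
  then have "at ((norm p)\<^sup>2) within {0..1} = at ((norm p)\<^sup>2) within {0..}"
    by (intro at_within_nhd[of _ "{..<1}"]) auto
  then have "(W has_real_derivative W') (at ((norm (upd b p (coord b p)))\<^sup>2) within {0..})"
    using assms(1) by simp
  then show ?thesis
  proof (rule DERIV_within_chain)
    show "((\<lambda>t. (norm (upd b p t))\<^sup>2) has_real_derivative 2 * coord b p) (at (coord b p))"
      unfolding norm_square_coord[of _ b] by (auto simp: coord_upd intro!: derivative_eq_intros)
  qed auto
qed

lemma dpartial_Cons: "dpartial (b # ws) f = partial b (dpartial ws f)"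
  and dpartial_Nil: "dpartial [] f = f"
  by (simp_all add: dpartial_def)

context
  fixes W W1 W2 :: "real \<Rightarrow> real"
  assumes dW: "\<And>t. t \<in> {0..<1} \<Longrightarrow> (W has_real_derivative W1 t) (at t within {0..1})"
    and dW1: "\<And>t. t \<in> {0..<1} \<Longrightarrow> (W1 has_real_derivative W2 t) (at t within {0..1})"
begin

lemma norm_square_less_1: "norm p < 1 \<Longrightarrow> (norm p)\<^sup>2 \<in> {0..<1}" for p :: R2
  by (simp add: abs_square_less_1)

lemma radial_has_partial:
  assumes "norm p < 1"
  shows "((\<lambda>t. W ((norm (upd b p t))\<^sup>2)) has_real_derivative 2 * W1 ((norm p)\<^sup>2) * coord b p) (at (coord b p))"
  using has_real_derivative_upd_radial[OF dW assms, of b] norm_square_less_1[OF assms]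
  by (simp add: mult_ac)

lemma radial_partial:
  "norm p < 1 \<Longrightarrow> partial b (\<lambda>x. W ((norm x)\<^sup>2)) p = 2 * W1 ((norm p)\<^sup>2) * coord b p"
  by (rule partial_eqI[OF radial_has_partial])

lemma radial_has_partial2:
  assumes "norm p < 1"
  shows "((\<lambda>t. partial b (\<lambda>x. W ((norm x)\<^sup>2)) (upd a p t)) has_real_derivative
    4 * W2 ((norm p)\<^sup>2) * coord a p * coord b p + (if a = b then 2 * W1 ((norm p)\<^sup>2) else 0)) (at (coord a p))"
proof (rule has_real_derivative_upd_cong_open[of "\<lambda>p. 2 * W1 ((norm p)\<^sup>2) * coord b p" _ _ _ "ball 0 1"])
  show "((\<lambda>t. 2 * W1 ((norm (upd a p t))\<^sup>2) * coord b (upd a p t)) has_real_derivative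
    4 * W2 ((norm p)\<^sup>2) * coord a p * coord b p + (if a = b then 2 * W1 ((norm p)\<^sup>2) else 0)) (at (coord a p))"
    using has_real_derivative_upd_radial[OF dW1 assms, of a] norm_square_less_1[OF assms]
    by (cases "a = b") (auto simp: coord_upd algebra_simps intro!: derivative_eq_intros)
qed (use assms in \<open>auto simp: radial_partial\<close>)

lemma radial_partial2:
  "norm p < 1 \<Longrightarrow> partial a (partial b (\<lambda>x. W ((norm x)\<^sup>2))) p =
    4 * W2 ((norm p)\<^sup>2) * coord a p * coord b p + (if a = b then 2 * W1 ((norm p)\<^sup>2) else 0)"
  by (rule partial_eqI[OF radial_has_partial2])

text \<open>The pure second derivatives add up to \<open>4 |x|^2 W'' + 4 W'\<close>, that is,
  \<open>4 (t W')'\<close> at \<open>t = |x|^2\<close>.\<close>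

lemma laplacian_radial:
  assumes "norm p < 1"
  shows "laplacian (\<lambda>x. W ((norm x)\<^sup>2)) p = 4 * (W1 ((norm p)\<^sup>2) + (norm p)\<^sup>2 * W2 ((norm p)\<^sup>2))"
proof -
  have "laplacian (\<lambda>x. W ((norm x)\<^sup>2)) p =
      4 * (W1 ((norm p)\<^sup>2) + ((coord True p)\<^sup>2 + (coord (\<not> True) p)\<^sup>2) * W2 ((norm p)\<^sup>2))"
    unfolding laplacian_def radial_partial2[OF assms] by (simp add: power2_eq_square algebra_simps)
  then show ?thesis unfolding norm_square_coord[symmetric] .
qed

lemma Ck_on_2_radial:
  assumes "continuous_on {0..<1} W1" "continuous_on {0..<1} W2"
  shows "Ck_on 2 (ball 0 1) (\<lambda>x. W ((norm x)\<^sup>2))"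
proof -
  let ?u = "\<lambda>x::R2. W ((norm x)\<^sup>2)"
  have comp: "continuous_on (ball 0 1) (\<lambda>x::R2. V ((norm x)\<^sup>2))" if "continuous_on {0..<1} V" for V :: "real \<Rightarrow> real"
    by (rule continuous_on_compose2[OF that])
       (auto intro!: continuous_intros simp: abs_square_less_1)
  have "continuous_on {0..<1} W"
    by (rule DERIV_continuous_on[OF DERIV_subset[OF dW]]) auto
  note c0 = comp[OF this] and c1 = comp[OF assms(1)] and c2 = comp[OF assms(2)]
  have C1: "continuous_on (ball 0 1) (partial b ?u)" for b
    by (subst continuous_on_cong[OF refl radial_partial]) (auto intro!: continuous_intros c1)
  have C2: "continuous_on (ball 0 1) (partial a (partial b ?u))" for a b
    by (cases "a = b"; subst continuous_on_cong[OF refl radial_partial2])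
       (auto intro!: continuous_intros c1 c2)
  show ?thesis unfolding Ck_on_def
  proof (intro conjI allI impI ballI)
    fix ws :: "bool list" assume "length ws \<le> 2"
    then consider "ws = []" | b where "ws = [b]" | a b where "ws = [a, b]"
      by (cases ws; cases "tl ws") (auto simp: length_Suc_conv)
    then show "continuous_on (ball 0 1) (dpartial ws ?u)"
      by cases (auto simp: dpartial_Cons dpartial_Nil c0 C1 C2)
  next
    fix ws :: "bool list" and a p assume "length ws < 2" and p: "p \<in> ball (0::R2) 1"
    then consider "ws = []" | b where "ws = [b]"
      by (cases ws) auto
    then show "has_partial a (dpartial ws ?u) p"
      using p by cases (auto simp: dpartial_Cons dpartial_Nil intro!: has_partialI radial_has_partial radial_has_partial2)
  qed
qed

end

section \<open>The weight \<open>2 - |x|^2\<close>\<close>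

text \<open>The last entries of a word act first, so the third equation covers all words of length
  at least 3: after the innermost derivatives \<open>a\<close>, \<open>b\<close> the function is
  constant.\<close>

lemma dpartial_paraboloid:
  "dpartial [b] (\<lambda>x::R2. 2 - (norm x)\<^sup>2) = (\<lambda>p. - 2 * coord b p)"
  "dpartial [a, b] (\<lambda>x::R2. 2 - (norm x)\<^sup>2) = (\<lambda>p. if a = b then - 2 else 0)"
  "dpartial (d # ws @ [a, b]) (\<lambda>x::R2. 2 - (norm x)\<^sup>2) = (\<lambda>p. 0)"
proof -
  show 1: "dpartial [b] (\<lambda>x::R2. 2 - (norm x)\<^sup>2) = (\<lambda>p. - 2 * coord b p)" for b
    unfolding dpartial_Cons dpartial_Nil
    by (rule ext, rule partial_eqI)
       (auto simp: norm_square_coord[of _ b] coord_upd intro!: derivative_eq_intros)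
  show 2: "dpartial [a, b] (\<lambda>x::R2. 2 - (norm x)\<^sup>2) = (\<lambda>p. if a = b then - 2 else 0)" for a b
    unfolding dpartial_Cons[of a] 1
    by (rule ext, rule partial_eqI) (auto simp: coord_upd intro!: derivative_eq_intros)
  show "dpartial (d # ws @ [a, b]) (\<lambda>x::R2. 2 - (norm x)\<^sup>2) = (\<lambda>p. 0)"
  proof (induction ws arbitrary: d)
    case Nil
    show ?case unfolding append_Nil dpartial_Cons[of d] 2
      by (rule ext, rule partial_eqI) auto
  next
    case (Cons e ws)
    show ?case unfolding append_Cons dpartial_Cons[of d] Cons
      by (rule ext, rule partial_eqI) auto
  qed
qed

text \<open>The cases match the explicit derivatives of the paraboloid: order 0, 1, 2 and at least
  3.\<close>

lemma bool_list_short_cases: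
  obtains "ws = []" | b where "ws = [b]" | a b where "ws = [a, b]" | d ws' a b where "ws = d # ws' @ [a, b]"
proof (cases "length ws \<le> 2")
  case True
  then show ?thesis using that(1-3)
    by (cases ws; cases "tl ws") (auto simp: length_Suc_conv)
next
  case False
  then obtain d vs where ws: "ws = d # vs" "length vs \<ge> 2" by (cases ws) auto
  then obtain xs b where vs: "vs = xs @ [b]" "length xs \<ge> 1" by (cases vs rule: rev_cases) auto
  then obtain ys a where "xs = ys @ [a]" by (cases xs rule: rev_cases) auto
  then show ?thesis using ws vs that(4)[of d ys a b] by simp
qed

lemma smooth_on_paraboloid: "smooth_on U (\<lambda>x::R2. 2 - (norm x)\<^sup>2)"
proof -
  let ?h = "\<lambda>x::R2. 2 - (norm x)\<^sup>2"
  have "continuous_on U (dpartial ws ?h)" for ws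
    by (cases ws rule: bool_list_short_cases)
       (auto simp only: dpartial_paraboloid dpartial_Nil intro!: continuous_intros)
  moreover have "has_partial e (dpartial ws ?h) p" for ws e p
  proof (cases ws rule: bool_list_short_cases)
    case 1
    show ?thesis unfolding 1 dpartial_Nil
      by (rule has_partialI[where D = "- 2 * coord e p"])
         (auto simp: norm_square_coord[of _ e] coord_upd intro!: derivative_eq_intros)
  next
    case (2 b)
    show ?thesis unfolding 2 dpartial_paraboloid
      by (rule has_partialI[where D = "if b = e then - 2 else 0"])
         (auto simp: coord_upd intro!: derivative_eq_intros)
  next
    case (3 a b)
    show ?thesis unfolding 3 dpartial_paraboloid by (rule has_partialI[where D = 0]) auto
  next
    case 4
    show ?thesis unfolding 4 dpartial_paraboloid by (rule has_partialI[where D = 0]) auto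
  qed
  ultimately show ?thesis by (simp add: smooth_on_def Ck_on_def)
qed

lemma abs_dpartial_paraboloid_le:
  assumes "norm x < 1" "ws \<noteq> []"
  shows "\<bar>dpartial ws (\<lambda>x::R2. 2 - (norm x)\<^sup>2) x\<bar> \<le> 2"
proof -
  have "\<bar>coord b x\<bar> \<le> norm x" for b
    using norm_fst_le[of "fst x" "snd x"] norm_snd_le[of "snd x" "fst x"] by (auto simp: coord_def)
  then have "\<bar>coord b x\<bar> \<le> 1" for b using assms(1) by (meson less_imp_le order_trans)
  then show ?thesis using assms(2)
    by (cases ws rule: bool_list_short_cases) (auto simp only: dpartial_paraboloid abs_mult; auto)+
qed

section \<open>Radial solutions with prescribed central value\<close>

text \<open>The decay and mass bounds depend on \<open>\<alpha>\<close> but not on the central value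
  \<open>A\<close>; they therefore remain uniform along a sequence with \<open>A\<close> tending to
  infinity.\<close>

definition radial_bubble :: "nat \<Rightarrow> real \<Rightarrow> (R2 \<Rightarrow> real) \<Rightarrow> bool" where
  "radial_bubble \<alpha> A u \<longleftrightarrow>
     u 0 = A \<and> continuous_on (cball 0 1) u \<and> Ck_on 2 (ball 0 1) u \<and>
     (\<forall>x\<in>ball 0 1. laplacian u x + norm x ^ (2 * \<alpha>) * (2 - (norm x)\<^sup>2) * exp (u x) = 0) \<and>
     (\<forall>x y. norm x = norm y \<longrightarrow> u x = u y) \<and>
     (\<forall>x. x \<noteq> 0 \<and> norm x \<le> 1 \<longrightarrow> exp (u x) \<le> 2 * (real \<alpha> + 1)\<^sup>2 / norm x ^ (2 * (\<alpha> + 1))) \<and>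
     (\<lambda>x. norm x ^ (2 * \<alpha>) * (2 - (norm x)\<^sup>2) * exp (u x)) integrable_on ball 0 1 \<and>
     integral (ball 0 1) (\<lambda>x. norm x ^ (2 * \<alpha>) * (2 - (norm x)\<^sup>2) * exp (u x)) \<le> 8 * pi * (real \<alpha> + 1)"

lemma radial_bubble_exists: "\<exists>u. radial_bubble \<alpha> A u"
proof -
  \<comment> \<open>With \<open>t = |x|^2\<close>, the power is \<open>|x|^(2 \<alpha>)\<close>, the
    factor \<open>2 - t\<close> is the weight, and 4 is the factor in the radial Laplacian.\<close>
  define H where "H t = t ^ \<alpha> * (2 - t) / 4" for t :: real
  define H' where "H' t = (real \<alpha> * t ^ (\<alpha> - 1) * (2 - t) - t ^ \<alpha>) / 4" for t :: real
  have dH: "(H has_real_derivative H' t) (at t within {0..1})" for t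
    unfolding H_def H'_def by (auto intro!: derivative_eq_intros simp: field_simps)
  have cH: "continuous_on {0..1} H" by (rule DERIV_continuous_on[OF dH])
  have cH': "continuous_on {0..1} H'" unfolding H'_def by (intro continuous_intros) auto
  have H0: "0 \<le> H t" if "t \<in> {0..1}" for t using that by (simp add: H_def)
  \<comment> \<open>The Pohozaev exponent is \<open>n = \<alpha> + 1\<close>. The power alone would
    give equality; the decreasing factor \<open>2 - t\<close> contributes
    \<open>- t^(\<alpha>+1) / 4\<close>.\<close>
  have tH': "t * H' t \<le> ((real \<alpha> + 1) - 1) * H t" if "t \<in> {0..1}" for t
  proof -
    \<comment> \<open>For \<open>\<alpha> = 0\<close> the exponent \<open>\<alpha> - 1\<close> is
      truncated to 0, and the factor \<open>real \<alpha>\<close> makes both sides vanish.\<close>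
    have *: "t * (real \<alpha> * t ^ (\<alpha> - 1)) = real \<alpha> * t ^ \<alpha>" by (cases \<alpha>) auto
    have "t * H' t = (t * (real \<alpha> * t ^ (\<alpha> - 1))) * (2 - t) / 4 - t ^ (\<alpha> + 1) / 4"
      by (simp add: H'_def field_simps)
    also have "\<dots> = real \<alpha> * H t - t ^ (\<alpha> + 1) / 4"
      unfolding * by (simp add: H_def)
    finally show ?thesis using that by simp
  qed
  obtain v v1 v2 where v0: "v 0 = A" and c1: "continuous_on {0..1} v1" and c2: "continuous_on {0..1} v2"
    and dv: "\<And>t. t \<in> {0..1} \<Longrightarrow> (v has_real_derivative v1 t) (at t within {0..1})"
    and dv1: "\<And>t. t \<in> {0..1} \<Longrightarrow> (v1 has_real_derivative v2 t) (at t within {0..1})"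
    and eq: "\<And>t. t \<in> {0..1} \<Longrightarrow> v1 t + t * v2 t = - H t * exp (v t)"
    by (rule radial_liouville_solution[of H H' A]) (use dH cH' H0 in auto)
  note bounds = pohozaev_bounds[OF dH H0 tH' _ dv dv1 eq]
  have cv: "continuous_on {0..1} v" by (rule DERIV_continuous_on[OF dv])
  define F where "F t = 4 * (H t * exp (v t))" for t
  have cF: "continuous_on {0..1} F" unfolding F_def by (intro continuous_intros cH cv)
  define u where "u x = v ((norm x)\<^sup>2)" for x :: R2
  have FH: "norm x ^ (2 * \<alpha>) * (2 - (norm x)\<^sup>2) * exp (u x) = F ((norm x)\<^sup>2)" for x
    by (simp add: F_def H_def u_def power_mult)
  note int = radial_integral_unit_disk[OF cF, folded FH]
  have "radial_bubble \<alpha> A u"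
    unfolding radial_bubble_def
  proof (intro conjI ballI allI impI)
    show "u 0 = A" by (simp add: u_def v0)
    show "continuous_on (cball 0 1) u"
      unfolding u_def by (rule continuous_on_compose2[OF cv]) (auto intro!: continuous_intros power_le_one)
    show "Ck_on 2 (ball 0 1) u"
      unfolding u_def by (rule Ck_on_2_radial[of v v1 v2])
        (auto intro!: dv dv1 intro: continuous_on_subset[OF c1] continuous_on_subset[OF c2])
    fix x :: R2
    assume "x \<in> ball 0 1"
    then have x: "norm x < 1" by simp
    then have N: "(norm x)\<^sup>2 \<in> {0..1}" by (simp add: power_le_one)
    have "laplacian u x = 4 * (v1 ((norm x)\<^sup>2) + (norm x)\<^sup>2 * v2 ((norm x)\<^sup>2))"
      unfolding u_def by (rule laplacian_radial[OF _ _ x]) (auto intro: dv dv1)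
    then show "laplacian u x + norm x ^ (2 * \<alpha>) * (2 - (norm x)\<^sup>2) * exp (u x) = 0"
      unfolding FH eq[OF N] by (simp add: F_def)
  next
    fix x y :: R2 assume "norm x = norm y"
    then show "u x = u y" by (simp add: u_def)
  next
    fix x :: R2 assume x: "x \<noteq> 0 \<and> norm x \<le> 1"
    let ?t = "(norm x)\<^sup>2"
    have t: "?t \<in> {0..1}" using x by (simp add: power_le_one)
    \<comment> \<open>The weight is at least 1 on the closed disk. Combined with the Pohozaev bound
      \<open>n^2 / 2\<close>, this yields the constant \<open>4 * n^2 / 2 = 2 * n^2\<close>.\<close>
    have "?t ^ (\<alpha> + 1) / 4 * exp (u x) \<le> ?t * H ?t * exp (v ?t)"
    proof -
      have "?t ^ (\<alpha> + 1) / 4 * 1 \<le> ?t ^ (\<alpha> + 1) / 4 * (2 - ?t)"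
        using t by (intro mult_left_mono) auto
      also have "\<dots> = ?t * H ?t" by (simp add: H_def)
      finally have "?t ^ (\<alpha> + 1) / 4 \<le> ?t * H ?t" by simp
      from mult_right_mono[OF this exp_ge_zero] show ?thesis by (simp add: u_def)
    qed
    also have "\<dots> \<le> (real \<alpha> + 1)\<^sup>2 / 2" by (rule bounds(1)) (use t in auto)
    finally show "exp (u x) \<le> 2 * (real \<alpha> + 1)\<^sup>2 / norm x ^ (2 * (\<alpha> + 1))"
      unfolding power_mult[of "norm x" 2] using x by (simp add: field_simps del: power_Suc)
  next
    show "(\<lambda>x. norm x ^ (2 * \<alpha>) * (2 - (norm x)\<^sup>2) * exp (u x)) integrable_on ball 0 1"
      using int by (rule has_integral_integrable)
    have "integral (ball 0 1) (\<lambda>x. norm x ^ (2 * \<alpha>) * (2 - (norm x)\<^sup>2) * exp (u x)) =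
        4 * pi * integral {0..1} (\<lambda>t. H t * exp (v t))"
      using int by (simp add: has_integral_iff F_def[abs_def])
    also have "\<dots> \<le> 4 * pi * (2 * (real \<alpha> + 1))"
      by (intro mult_left_mono bounds(2)) auto
    also have "\<dots> = 8 * pi * (real \<alpha> + 1)" by simp
    finally show "integral (ball 0 1) (\<lambda>x. norm x ^ (2 * \<alpha>) * (2 - (norm x)\<^sup>2) * exp (u x)) \<le> 8 * pi * (real \<alpha> + 1)" .
  qed
  then show ?thesis by (rule exI[of _ u])
qed

text \<open>At the origin only \<open>4 W'(0)\<close> remains, and \<open>W(t) = ln (2 - t)\<close>
  has \<open>W'(0) = - 1 / 2\<close>.\<close>

lemma laplacian_ln_paraboloid: "laplacian (\<lambda>x::R2. ln (2 - (norm x)\<^sup>2)) 0 = - 2"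
proof -
  have "laplacian (\<lambda>x::R2. ln (2 - (norm x)\<^sup>2)) 0 =
      4 * (- 1 / (2 - (norm (0::R2))\<^sup>2) + (norm (0::R2))\<^sup>2 * (- 1 / (2 - (norm (0::R2))\<^sup>2)\<^sup>2))"
    by (rule laplacian_radial[of "\<lambda>t. ln (2 - t)" "\<lambda>t. - 1 / (2 - t)" "\<lambda>t. - 1 / (2 - t)\<^sup>2"])
       (auto intro!: derivative_eq_intros simp: power2_eq_square field_simps)
  then show ?thesis by simp
qed

section \<open>The blow-up sequence with central values \<open>k\<close>\<close>

theorem theorem1p2:
  fixes \<alpha> :: nat
  shows "\<exists>(c::real) (c1::real) (h :: nat \<Rightarrow> R2 \<Rightarrow> real) (u :: nat \<Rightarrow> R2 \<Rightarrow> real).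
    c > 0 \<and> c1 > 0 \<and>
    (\<forall>k. smooth_on (ball 0 1) (h k)) \<and>
    (\<forall>k. continuous_on (cball 0 1) (u k) \<and> Ck_on 2 (ball 0 1) (u k) \<and>
         (\<forall>x\<in>ball 0 1. laplacian (u k) x + norm x ^ (2 * \<alpha>) * h k x * exp (u k x) = 0)) \<and>
    (\<forall>k. \<forall>x\<in>ball 0 1. 1 / c1 \<le> h k x \<and> h k x \<le> c1 \<and>
         (\<forall>ws. 1 \<le> length ws \<and> length ws \<le> 3 \<longrightarrow> \<bar>dpartial ws (h k) x\<bar> \<le> c1)) \<and>
    (\<forall>k. \<bar>laplacian (\<lambda>x. ln (h k x)) 0\<bar> \<ge> c) \<and>
    blowup_only_at_origin u \<and> spherical_harnack u \<and>
    (\<exists>C>0. \<forall>k.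
       (\<forall>x y. norm x = 1 \<and> norm y = 1 \<longrightarrow> \<bar>u k x - u k y\<bar> \<le> C) \<and>
       (\<lambda>x. norm x ^ (2 * \<alpha>) * h k x * exp (u k x)) integrable_on ball 0 1 \<and>
       integral (ball 0 1) (\<lambda>x. norm x ^ (2 * \<alpha>) * h k x * exp (u k x)) \<le> C)"
proof -
  have "\<forall>k::nat. \<exists>u. radial_bubble \<alpha> (real k) u"
    using radial_bubble_exists by blast
  from choice[OF this] obtain u where "\<And>k::nat. radial_bubble \<alpha> (real k) (u k)"
    by blast
  then have u: "u k 0 = real k" "continuous_on (cball 0 1) (u k)" "Ck_on 2 (ball 0 1) (u k)"
    "\<forall>x\<in>ball 0 1. laplacian (u k) x + norm x ^ (2 * \<alpha>) * (2 - (norm x)\<^sup>2) * exp (u k x) = 0"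
    "\<forall>x y. norm x = norm y \<longrightarrow> u k x = u k y"
    "\<forall>x. x \<noteq> 0 \<and> norm x \<le> 1 \<longrightarrow> exp (u k x) \<le> 2 * (real \<alpha> + 1)\<^sup>2 / norm x ^ (2 * (\<alpha> + 1))"
    "(\<lambda>x. norm x ^ (2 * \<alpha>) * (2 - (norm x)\<^sup>2) * exp (u k x)) integrable_on ball 0 1"
    "integral (ball 0 1) (\<lambda>x. norm x ^ (2 * \<alpha>) * (2 - (norm x)\<^sup>2) * exp (u k x)) \<le> 8 * pi * (real \<alpha> + 1)"
    for k
    unfolding radial_bubble_def atomize_conj conj_assoc .
  have radial: "u k x = u k y" if "norm x = norm y" for k x y
    using u(5)[of k] that by blast
  have blowup: "blowup_only_at_origin u"
    unfolding blowup_only_at_origin_def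
  proof (intro conjI allI impI)
    \<comment> \<open>The constant sequence at the origin works, because the central value of
      \<open>u k\<close> is \<open>k\<close>.\<close>
    show "\<exists>x. (\<forall>k. x k \<in> ball (0::R2) 1) \<and> x \<longlonglongrightarrow> 0 \<and> filterlim (\<lambda>k. u k (x k)) at_top sequentially"
      by (rule exI[of _ "\<lambda>_. 0"]) (simp add: u(1) filterlim_real_sequentially)
    fix K :: "R2 set" assume K: "compact K \<and> K \<subseteq> cball 0 1 - {0}"
    then have "open (- K)" "0 \<in> - K" by (auto intro: compact_imp_closed)
    then obtain d where d: "d > 0" "ball 0 d \<subseteq> - K" by (meson openE)
    \<comment> \<open>This is the decay bound for \<open>exp (u k y)\<close> at distance
      \<open>d\<close> from the origin, the largest it can be on \<open>K\<close>.\<close>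
    define M where "M = 2 * (real \<alpha> + 1)\<^sup>2 / d ^ (2 * (\<alpha> + 1))"
    have M: "M > 0" using d by (simp add: M_def)
    have "u k y \<le> ln M" if y: "y \<in> K" for k y
    proof -
      have "y \<notin> ball 0 d" "y \<in> cball 0 1 - {0}" using y d(2) K by blast+
      then have "d \<le> norm y" "y \<noteq> 0" "norm y \<le> 1" by auto
      have "exp (u k y) \<le> 2 * (real \<alpha> + 1)\<^sup>2 / norm y ^ (2 * (\<alpha> + 1))"
        using u(6)[of k] \<open>y \<noteq> 0\<close> \<open>norm y \<le> 1\<close> by blast
      also have "\<dots> \<le> M"
        unfolding M_def using \<open>d \<le> norm y\<close> d(1) by (intro divide_left_mono power_mono mult_pos_pos zero_less_power) auto
      finally show ?thesis using M by (simp add: ln_ge_iff)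
    qed
    then show "\<exists>M. \<forall>k. \<forall>y\<in>K. u k y \<le> M" by blast
  qed
  have harnack: "spherical_harnack u"
    unfolding spherical_harnack_def
  \<comment> \<open>Radial functions have no oscillation on circles; 1 is just a positive
    constant.\<close>
  proof (intro exI[of _ 1] conjI allI impI)
    fix k r and x y :: R2 assume "0 < r \<and> r < 1 \<and> norm x = r \<and> norm y = r"
    then show "\<bar>u k x - u k y\<bar> \<le> 1" using radial[of x y k] by simp
  qed simp
  have h: "\<forall>k::nat. \<forall>x\<in>ball (0::R2) 1. 1 / 2 \<le> 2 - (norm x)\<^sup>2 \<and> 2 - (norm x)\<^sup>2 \<le> 2 \<and>
      (\<forall>ws. 1 \<le> length ws \<and> length ws \<le> 3 \<longrightarrow> \<bar>dpartial ws (\<lambda>x. 2 - (norm x)\<^sup>2) x\<bar> \<le> 2)"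
  proof (intro allI ballI conjI impI)
    fix x :: R2 and ws :: "bool list" assume x: "x \<in> ball 0 1"
    then have "(norm x)\<^sup>2 \<le> 1" by (simp add: power_le_one)
    then show "1 / 2 \<le> 2 - (norm x)\<^sup>2" "2 - (norm x)\<^sup>2 \<le> 2" by auto
    assume "1 \<le> length ws \<and> length ws \<le> 3"
    then have "ws \<noteq> []" by auto
    then show "\<bar>dpartial ws (\<lambda>x. 2 - (norm x)\<^sup>2) x\<bar> \<le> 2"
      using x abs_dpartial_paraboloid_le by simp
  qed
  have mass: "\<exists>C>0. \<forall>k. (\<forall>x y. norm x = 1 \<and> norm y = 1 \<longrightarrow> \<bar>u k x - u k y\<bar> \<le> C) \<and>
       (\<lambda>x. norm x ^ (2 * \<alpha>) * (2 - (norm x)\<^sup>2) * exp (u k x)) integrable_on ball 0 1 \<and>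
       integral (ball 0 1) (\<lambda>x. norm x ^ (2 * \<alpha>) * (2 - (norm x)\<^sup>2) * exp (u k x)) \<le> C"
  proof (intro exI[of _ "8 * pi * (real \<alpha> + 1)"] conjI allI impI u(7,8))
    fix k and x y :: R2 assume "norm x = 1 \<and> norm y = 1"
    then show "\<bar>u k x - u k y\<bar> \<le> 8 * pi * (real \<alpha> + 1)" using radial[of x y k] by simp
  qed simp
  have "\<bar>laplacian (\<lambda>x::R2. ln (2 - (norm x)\<^sup>2)) 0\<bar> \<ge> 2"
    by (simp add: laplacian_ln_paraboloid)
  then have laplacian: "\<forall>k::nat. \<bar>laplacian (\<lambda>x::R2. ln (2 - (norm x)\<^sup>2)) 0\<bar> \<ge> 2" ..
  have smooth: "\<forall>k::nat. smooth_on (ball 0 1) (\<lambda>x::R2. 2 - (norm x)\<^sup>2)"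
    using smooth_on_paraboloid ..
  have pde: "\<forall>k. continuous_on (cball 0 1) (u k) \<and> Ck_on 2 (ball 0 1) (u k) \<and>
      (\<forall>x\<in>ball 0 1. laplacian (u k) x + norm x ^ (2 * \<alpha>) * (2 - (norm x)\<^sup>2) * exp (u k x) = 0)"
    by (intro allI conjI u)
  \<comment> \<open>The witness \<open>c = 2\<close> is the size of the Laplacian of
    \<open>log h\<close> at 0; \<open>c1 = 2\<close> bounds both \<open>h\<close>, which lies
    between 1 and 2, and its derivatives.\<close>
  show ?thesis
    by (rule exI[of _ 2], rule exI[of _ 2], rule exI[of _ "\<lambda>_ x. 2 - (norm x)\<^sup>2"], rule exI[of _ u],
        intro conjI smooth pde h laplacian blowup harnack mass) simp_all
qed

end
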